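(* Let $\Phi:\mathbb{R}_+\to\mathbb{R}_+$ and suppose that for every $\mathcal{L}>0$ all of the following conditions hold. (1) $\Phi$ is monotonically increasing. (2) $\int_x^\infty \frac{dt}{\Phi(t)}<\infty$ for every $x>0$. (3) For every closed curve $f$ (as in the context) with $\mathcal{E}_\Phi(f)<\infty$, one has $f\in W_\Phi\cap W^{1,\infty}(\mathbb{R}/\mathcal{L}\mathbb{Z})$ and $f$ is bi-Lipschitz. (4) For every bi-Lipschitz $f\in W_\Phi\cap W^{1,\infty}(\mathbb{R}/\mathcal{L}\mathbb{Z})$ with $\|f'\|_{\mathbb{R}^n}=1$ a.e., $$\lim_{\epsilon\to+0}\epsilon\int_{\mathbb{R}/\mathcal{L}\mathbb{Z}}\bigl(\Lambda(\|f(s_1)-f(s_1+\epsilon)\|_{\mathbb{R}^n})-\Lambda(\epsilon)\bigr)\,ds_1=0$$ and $$\lim_{\epsilon\to+0}\int_{\mathbb{R}/\mathcal{L}\mathbb{Z}}\Lambda(\|f(s_1)-f(s_1+\epsilon)\|_{\mathbb{R}^n})\int_{s_1}^{s_1+\epsilon}\|f'(s_1)-f'(s_2)\|_{\mathbb{R}^n}^2\,ds_2\,ds_1=0.$$ (5) (a) For every $\lambda\in(0,1)$ there is a constant $C(\lambda,\mathcal{L})>0$ such that $\Phi(\lambda x)\geq C(\lambda,\mathcal{L})\Phi(x)$ for every $x\in(0,\frac{\mathcal{L}}{2}]$; (b) $\inf_{x\in(0,\mathcal{L}/2]}\left(\frac{1}{\Phi(x)}+\Lambda(x)\right)\geq 0$.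 Let $j\in\{1,2\}$, let $f$ be a closed curve (as in the context), and let $\phi,\psi:\mathbb{R}/\mathcal{L}\mathbb{Z}\to\mathbb{R}^n$ be variation directions. The following identities hold at pairs $(s_1,s_2)$, $s_1\neq s_2$, where the derivatives of $f,\phi,\psi$ involved exist. If $\Phi_j\in C^1(0,\infty)$, then $$\mathscr{G}_{\Phi,j}(f)[\phi]=\frac{Q_{j,1}f\cdot Q_{j,2}\phi+Q_{j,2}f\cdot Q_{j,1}\phi}{\Phi_j(\|\Delta f\|_{\mathbb{R}^n})}-\frac{\mathscr{M}_{\Phi,j}(f)\,\Phi_j'(\|\Delta f\|_{\mathbb{R}^n})\,\Delta f\cdot\Delta\phi}{\|\Delta f\|_{\mathbb{R}^n}\,\Phi_j(\|\Delta f\|_{\mathbb{R}^n})}.$$ If $\Phi_j\in C^2(0,\infty)$, then $$\begin{aligned}\mathscr{H}_{\Phi,j}(f)[\phi,\psi]=\;&\frac{Q_{j,1}\phi\cdot Q_{j,2}\psi+Q_{j,2}\phi\cdot Q_{j,1}\psi-\left(S_{j,1}(f,\phi)S_{j,2}(f,\psi)+S_{j,2}(f,\phi)S_{j,1}(f,\psi)\right)}{\Phi_j(\|\Delta f\|_{\mathbb{R}^n})}\\&-\mathscr{G}_{\Phi,j}(f)[\phi]\,\Xi_j(\|\Delta f\|_{\mathbb{R}^n})\frac{\Delta f\cdot\Delta\psi}{\|\Delta f\|_{\mathbb{R}^n}^2}-\mathscr{G}_{\Phi,j}(f)[\psi]\,\Xi_j(\|\Delta f\|_{\mathbb{R}^n})\frac{\Delta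 f\cdot\Delta\phi}{\|\Delta f\|_{\mathbb{R}^n}^2}\\&-\mathscr{M}_{\Phi,j}(f)\,\Xi_j(\|\Delta f\|_{\mathbb{R}^n})\frac{\Delta\phi\cdot\Delta\psi}{\|\Delta f\|_{\mathbb{R}^n}^2}\\&+\mathscr{M}_{\Phi,j}(f)\left(2\,\Xi_j(\|\Delta f\|_{\mathbb{R}^n})-\Xi_j(\|\Delta f\|_{\mathbb{R}^n})^2-\|\Delta f\|_{\mathbb{R}^n}\,\Xi_j'(\|\Delta f\|_{\mathbb{R}^n})\right)\frac{(\Delta f\cdot\Delta\phi)(\Delta f\cdot\Delta\psi)}{\|\Delta f\|_{\mathbb{R}^n}^4}.\end{aligned}$$
   Context: $\mathbb{R}_+=\{x\in\mathbb{R}: x>0\}$. A closed curve $f:\mathbb{R}/\mathcal{L}\mathbb{Z}\to\mathbb{R}^n$ here means a closed curve without self-intersections, of total length $\mathcal{L}$, parametrized by arc-length $s$; $\tau=f'$ is its unit tangent vector (defined a.e.). For a function $u$ on $\mathbb{R}/\mathcal{L}\mathbb{Z}$: $u_i=u(s_i)$, $\Delta u=u(s_1)-u(s_2)$, $'$ denotes the derivative with respect to $s$; $\Delta s=s_1-s_2$ (taken with $|\Delta s|\le\mathcal{L}/2$). With $\mathscr{D}(f(s_1),f(s_2))=\mathrm{dist}_{\mathbb{R}/\mathcal{L}\mathbb{Z}}(s_1,s_2)$, $$\mathcal{E}_\Phi(f)=\iint_{(\mathbb{R}/\mathcal{L}\mathbb{Z})^2}\left(\frac{1}{\Phi(\|\Delta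 f\|_{\mathbb{R}^n})}-\frac{1}{\Phi(\mathscr{D}(f(s_1),f(s_2)))}\right)ds_1ds_2,$$ $$W_\Phi=\left\{u\in W^{1,2}(\mathbb{R}/\mathcal{L}\mathbb{Z};\mathbb{R}^n)\ :\ \iint_{(\mathbb{R}/\mathcal{L}\mathbb{Z})^2}\frac{\|\Delta u'\|_{\mathbb{R}^n}^2}{\Phi(\mathrm{dist}_{\mathbb{R}/\mathcal{L}\mathbb{Z}}(s_1,s_2))}\,ds_1ds_2<\infty\right\},\qquad \Lambda(x)=-\frac1x\int_x^\infty\frac{dt}{\Phi(t)}.$$ Bi-Lipschitz means there are constants $c,C>0$ with $c\,\mathrm{dist}_{\mathbb{R}/\mathcal{L}\mathbb{Z}}(s_1,s_2)\le\|f(s_1)-f(s_2)\|_{\mathbb{R}^n}\le C\,\mathrm{dist}_{\mathbb{R}/\mathcal{L}\mathbb{Z}}(s_1,s_2)$. Densities: $$\mathscr{M}_{\Phi,1}(f)=\frac{\|\Delta\tau\|_{\mathbb{R}^n}^2}{2\Phi(\|\Delta f\|_{\mathbb{R}^n})},\qquad \mathscr{M}_{\Phi,2}(f)=\left(\frac{1}{\Phi(\|\Delta f\|_{\mathbb{R}^n})}-\Lambda(\|\Delta f\|_{\mathbb{R}^n})\right)\left\langle\tau(s_1)\wedge\frac{\Delta f}{\|\Delta f\|_{\mathbb{R}^n}},\ \tau(s_2)\wedge\frac{\Delta f}{\|\Delta f\|_{\mathbb{R}^n}}\right\rangle_{\bigwedge^2\mathbb{R}^n},$$ with $\langle a\wedge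 b,c\wedge d\rangle_{\bigwedge^2\mathbb{R}^n}=(a\cdot c)(b\cdot d)-(a\cdot d)(b\cdot c)$. Operators (depending on $f$, for $\mathbb{R}^n$-valued $v,w$ and $i=1,2$): $$R_1v=\frac{|\Delta s|\,\Delta v}{\|\Delta f\|_{\mathbb{R}^n}\,\Delta s},\quad R_2v=\tfrac12(v_1'+v_2'),\quad Q_{1,i}v=\Delta v'=v_1'-v_2',\quad Q_{2,i}v=(-1)^{i-1}2\{v_i'-(R_1f\cdot\tau_i)R_1v\},$$ $$S_{1,i}(v,w)=R_2v\cdot Q_{1,i}w+Q_{1,i}v\cdot R_2w,\qquad S_{2,i}(v,w)=R_1v\cdot Q_{2,i}w+Q_{2,i}v\cdot R_1w.$$ Functions: $\Phi_1(x)=2\Phi(x)$, $\Phi_2(x)=-4\left(\frac1{\Phi(x)}-\Lambda(x)\right)^{-1}$, $\Xi_j(x)=\frac{x\Phi_j'(x)}{\Phi_j(x)}$. (With these, $\mathscr{M}_{\Phi,j}(f)=Q_{j,1}f\cdot Q_{j,2}f/\Phi_j(\|\Delta f\|_{\mathbb{R}^n})$.) Variations: $\mathscr{G}_{\Phi,j}$ and $\mathscr{H}_{\Phi,j}$ are defined by $$\mathscr{G}_{\Phi,j}(f)[\phi]\,ds_1ds_2=\delta(\mathscr{M}_{\Phi,j}(f)\,ds_1ds_2)[\phi],\qquad \mathscr{H}_{\Phi,j}(f)[\phi,\psi]\,ds_1ds_2=\delta^2(\mathscr{M}_{\Phi,j}(f)\,ds_1ds_2)[\phi,\psi],$$ where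 $\delta F(f)[\phi]=\frac{d}{d\epsilon}F(f+\epsilon\phi)|_{\epsilon=0}$ and $\delta^2F(f)[\phi,\psi]=\frac{\partial^2}{\partial\epsilon\,\partial\eta}F(f+\epsilon\phi+\eta\psi)|_{\epsilon=\eta=0}$. Here the parameters $\theta_1,\theta_2$ (the arc-length parameters of the unperturbed $f$) are kept fixed, and for a perturbed curve $g$ the unit tangent is $\tau=g'/\|g'\|_{\mathbb{R}^n}$ and the line element $ds_i$ is that of $g$, i.e. $ds_i=\|g'(\theta_i)\|_{\mathbb{R}^n}d\theta_i$. *)

theory Defs
  imports "HOL-Analysis.Analysis"
begin

text \<open>
  Functions on the circle of length L are rendered as L-periodic functions on the reals
  (library locale predicate \<^locale>\<open>periodic_fun_simple\<close>), and integrals over the circle as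
  integrals over \<^term>\<open>{0..L}\<close>.  A function on the positive reals is a function on all reals
  whose values at nonpositive arguments are irrelevant.
\<close>

definition circle_dist :: "real \<Rightarrow> real \<Rightarrow> real \<Rightarrow> real" where
  "circle_dist L s t = (INF k::int. \<bar>s - t + of_int k * L\<bar>)"

definition curve_length :: "(real \<Rightarrow> real ^ 'n) \<Rightarrow> real \<Rightarrow> real \<Rightarrow> ereal" where
  "curve_length f a b =
     (SUP (m, t) \<in> {(m::nat, t::nat \<Rightarrow> real). mono t \<and> t 0 = a \<and> t m = b}.
        ereal (\<Sum>i<m. norm (f (t (Suc i)) - f (t i))))"

definition closed_curve :: "real \<Rightarrow> (real \<Rightarrow> real ^ 'n) \<Rightarrow> bool" where
  "closed_curve L f \<longleftrightarrow> 0 < L \<and> periodic_fun_simple f L \<and> inj_on f {0..<L} \<and>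
     (\<forall>a b. a \<le> b \<longrightarrow> curve_length f a b = ereal (b - a))"

definition bi_lipschitz :: "real \<Rightarrow> (real \<Rightarrow> real ^ 'n) \<Rightarrow> bool" where
  "bi_lipschitz L f \<longleftrightarrow> (\<exists>c>0. \<exists>C>0. \<forall>s1 s2.
     c * circle_dist L s1 s2 \<le> norm (f s1 - f s2) \<and>
     norm (f s1 - f s2) \<le> C * circle_dist L s1 s2)"

text \<open>
  The integrand is nonnegative for arc-length parametrised f and increasing \<^term>\<open>\<Phi>\<close>, since a
  chord is never longer than the arc; so nothing is lost by \<^const>\<open>ennreal\<close>.
\<close>
definition energy :: "(real \<Rightarrow> real) \<Rightarrow> real \<Rightarrow> (real \<Rightarrow> real ^ 'n) \<Rightarrow> ennreal" where
  "energy \<Phi> L f = (\<integral>\<^sup>+ s1 \<in> {0..L}. (\<integral>\<^sup>+ s2 \<in> {0..L}.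
     ennreal (1 / \<Phi> (norm (f s1 - f s2)) - 1 / \<Phi> (circle_dist L s1 s2)) \<partial>lborel) \<partial>lborel)"

definition smooth :: "(real \<Rightarrow> real) \<Rightarrow> bool" where
  "smooth \<eta> \<longleftrightarrow> (\<forall>k::nat. (deriv ^^ k) \<eta> differentiable_on UNIV)"

definition weak_derivative :: "real \<Rightarrow> (real \<Rightarrow> real ^ 'n) \<Rightarrow> (real \<Rightarrow> real ^ 'n) \<Rightarrow> bool" where
  "weak_derivative L u v \<longleftrightarrow>
     periodic_fun_simple u L \<and> u \<in> borel_measurable borel \<and> set_integrable lborel {0..L} u \<and>
     periodic_fun_simple v L \<and> v \<in> borel_measurable borel \<and> set_integrable lborel {0..L} v \<and>
     (\<forall>\<eta>. smooth \<eta> \<and> periodic_fun_simple \<eta> L \<longrightarrow>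
        (LINT s:{0..L}|lborel. deriv \<eta> s *\<^sub>R u s) = - (LINT s:{0..L}|lborel. \<eta> s *\<^sub>R v s))"

definition in_L2 :: "real \<Rightarrow> (real \<Rightarrow> real ^ 'n) \<Rightarrow> bool" where
  "in_L2 L u \<longleftrightarrow> set_integrable lborel {0..L} (\<lambda>s. (norm (u s))\<^sup>2)"

definition in_Linf :: "real \<Rightarrow> (real \<Rightarrow> real ^ 'n) \<Rightarrow> bool" where
  "in_Linf L u \<longleftrightarrow> (\<exists>C. AE s in lborel. s \<in> {0..L} \<longrightarrow> norm (u s) \<le> C)"

definition W12 :: "real \<Rightarrow> (real \<Rightarrow> real ^ 'n) set" where
  "W12 L = {u. in_L2 L u \<and> (\<exists>v. weak_derivative L u v \<and> in_L2 L v)}"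

definition W1inf :: "real \<Rightarrow> (real \<Rightarrow> real ^ 'n) set" where
  "W1inf L = {u. in_Linf L u \<and> (\<exists>v. weak_derivative L u v \<and> in_Linf L v)}"

text \<open>
  The weak derivative is unique up to null sets, so the double integral does not depend on the
  choice of v.
\<close>
definition W_Phi :: "(real \<Rightarrow> real) \<Rightarrow> real \<Rightarrow> (real \<Rightarrow> real ^ 'n) set" where
  "W_Phi \<Phi> L = {u \<in> W12 L. \<exists>v. weak_derivative L u v \<and>
     (\<integral>\<^sup>+ s1 \<in> {0..L}. (\<integral>\<^sup>+ s2 \<in> {0..L}.
        ennreal ((norm (v s1 - v s2))\<^sup>2 / \<Phi> (circle_dist L s1 s2)) \<partial>lborel) \<partial>lborel) < \<infinity>}"

definition Lam :: "(real \<Rightarrow> real) \<Rightarrow> real \<Rightarrow> real" where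
  "Lam \<Phi> x = - (1 / x) * (LINT t:{x..}|lborel. 1 / \<Phi> t)"

definition Phi_fun :: "(real \<Rightarrow> real) \<Rightarrow> nat \<Rightarrow> real \<Rightarrow> real" where
  "Phi_fun \<Phi> j x = (if j = 1 then 2 * \<Phi> x else - 4 * inverse (1 / \<Phi> x - Lam \<Phi> x))"

definition Xi :: "(real \<Rightarrow> real) \<Rightarrow> nat \<Rightarrow> real \<Rightarrow> real" where
  "Xi \<Phi> j x = x * deriv (Phi_fun \<Phi> j) x / Phi_fun \<Phi> j x"

definition C1_pos :: "(real \<Rightarrow> real) \<Rightarrow> bool" where
  "C1_pos h \<longleftrightarrow> h differentiable_on {0<..} \<and> continuous_on {0<..} (deriv h)"

definition C2_pos :: "(real \<Rightarrow> real) \<Rightarrow> bool" where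
  "C2_pos h \<longleftrightarrow> C1_pos h \<and> C1_pos (deriv h)"

abbreviation vd :: "(real \<Rightarrow> real ^ 'n) \<Rightarrow> real \<Rightarrow> real ^ 'n" where
  "vd u s \<equiv> vector_derivative u (at s)"

definition tangent :: "(real \<Rightarrow> real ^ 'n) \<Rightarrow> real \<Rightarrow> real ^ 'n" where
  "tangent g s = vd g s /\<^sub>R norm (vd g s)"

text \<open>
  An arc-length parametrised curve has a derivative of norm 1 almost everywhere, but on a null set
  the derivative may exist and be shorter; the unit tangent \<open>\<tau> = f'\<close> exists only at the former
  points.
\<close>
definition has_unit_tangent :: "(real \<Rightarrow> real ^ 'n) \<Rightarrow> real \<Rightarrow> bool" where
  "has_unit_tangent f s \<longleftrightarrow> f differentiable (at s) \<and> norm (vd f s) = 1"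

definition wedge_inner :: "real ^ 'n \<Rightarrow> real ^ 'n \<Rightarrow> real ^ 'n \<Rightarrow> real ^ 'n \<Rightarrow> real" where
  "wedge_inner a b c d = (a \<bullet> c) * (b \<bullet> d) - (a \<bullet> d) * (b \<bullet> c)"

definition M_dens ::
  "(real \<Rightarrow> real) \<Rightarrow> nat \<Rightarrow> (real \<Rightarrow> real ^ 'n) \<Rightarrow> real \<Rightarrow> real \<Rightarrow> real" where
  "M_dens \<Phi> j g s1 s2 =
     (let \<Delta>g = g s1 - g s2; r = norm \<Delta>g; u = \<Delta>g /\<^sub>R r in
      if j = 1 then (norm (tangent g s1 - tangent g s2))\<^sup>2 / (2 * \<Phi> r)
      else (1 / \<Phi> r - Lam \<Phi> r) * wedge_inner (tangent g s1) u (tangent g s2) u)"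

text \<open>
  The density of \<open>M(g) ds\<^sub>1 ds\<^sub>2\<close> with respect to the fixed parameters, \<open>ds\<^sub>i\<close> being the line element
  of g.
\<close>
definition M_form ::
  "(real \<Rightarrow> real) \<Rightarrow> nat \<Rightarrow> (real \<Rightarrow> real ^ 'n) \<Rightarrow> real \<Rightarrow> real \<Rightarrow> real" where
  "M_form \<Phi> j g \<theta>1 \<theta>2 = M_dens \<Phi> j g \<theta>1 \<theta>2 * norm (vd g \<theta>1) * norm (vd g \<theta>2)"

text \<open>
  The parameters are the arc-length parameters of f, so
  \<open>ds\<^sub>i = d\<theta>\<^sub>i\<close> for f itself and no line elements have to be divided out.
\<close>
definition G_var ::
  "(real \<Rightarrow> real) \<Rightarrow> nat \<Rightarrow> (real \<Rightarrow> real ^ 'n) \<Rightarrow> (real \<Rightarrow> real ^ 'n) \<Rightarrow> real \<Rightarrow> real \<Rightarrow> real" where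
  "G_var \<Phi> j f \<phi> s1 s2 = deriv (\<lambda>\<epsilon>. M_form \<Phi> j (\<lambda>s. f s + \<epsilon> *\<^sub>R \<phi> s) s1 s2) 0"

definition pert2 ::
  "(real \<Rightarrow> real) \<Rightarrow> nat \<Rightarrow> (real \<Rightarrow> real ^ 'n) \<Rightarrow> (real \<Rightarrow> real ^ 'n) \<Rightarrow> (real \<Rightarrow> real ^ 'n) \<Rightarrow>
   real \<Rightarrow> real \<Rightarrow> real \<Rightarrow> real \<Rightarrow> real" where
  "pert2 \<Phi> j f \<phi> \<psi> s1 s2 \<epsilon> \<eta> =
     M_form \<Phi> j (\<lambda>s. f s + \<epsilon> *\<^sub>R \<phi> s + \<eta> *\<^sub>R \<psi> s) s1 s2"

definition H_var ::
  "(real \<Rightarrow> real) \<Rightarrow> nat \<Rightarrow> (real \<Rightarrow> real ^ 'n) \<Rightarrow> (real \<Rightarrow> real ^ 'n) \<Rightarrow> (real \<Rightarrow> real ^ 'n) \<Rightarrow>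
   real \<Rightarrow> real \<Rightarrow> real" where
  "H_var \<Phi> j f \<phi> \<psi> s1 s2 = deriv (\<lambda>\<epsilon>. deriv (\<lambda>\<eta>. pert2 \<Phi> j f \<phi> \<psi> s1 s2 \<epsilon> \<eta>) 0) 0"

text \<open>
  \<^const>\<open>deriv\<close> has a value even where no derivative exists, so existence of the variations is
  expressed separately.
\<close>
definition G_exists ::
  "(real \<Rightarrow> real) \<Rightarrow> nat \<Rightarrow> (real \<Rightarrow> real ^ 'n) \<Rightarrow> (real \<Rightarrow> real ^ 'n) \<Rightarrow> real \<Rightarrow> real \<Rightarrow> bool" where
  "G_exists \<Phi> j f \<phi> s1 s2 \<longleftrightarrow>
     (\<lambda>\<epsilon>. M_form \<Phi> j (\<lambda>s. f s + \<epsilon> *\<^sub>R \<phi> s) s1 s2) differentiable (at 0)"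

definition H_exists ::
  "(real \<Rightarrow> real) \<Rightarrow> nat \<Rightarrow> (real \<Rightarrow> real ^ 'n) \<Rightarrow> (real \<Rightarrow> real ^ 'n) \<Rightarrow> (real \<Rightarrow> real ^ 'n) \<Rightarrow>
   real \<Rightarrow> real \<Rightarrow> bool" where
  "H_exists \<Phi> j f \<phi> \<psi> s1 s2 \<longleftrightarrow>
     (\<forall>\<^sub>F \<epsilon> in nhds 0. (\<lambda>\<eta>. pert2 \<Phi> j f \<phi> \<psi> s1 s2 \<epsilon> \<eta>) differentiable (at 0)) \<and>
     (\<lambda>\<epsilon>. deriv (\<lambda>\<eta>. pert2 \<Phi> j f \<phi> \<psi> s1 s2 \<epsilon> \<eta>) 0) differentiable (at 0)"

text \<open>
  All operators act at a pair (s1, s2) of representatives with \<open>\<bar>s1 - s2\<bar> \<le> L / 2\<close>, so that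
  \<open>\<Delta>s = s1 - s2\<close>.
\<close>

definition R_op ::
  "nat \<Rightarrow> (real \<Rightarrow> real ^ 'n) \<Rightarrow> real \<Rightarrow> real \<Rightarrow> (real \<Rightarrow> real ^ 'n) \<Rightarrow> real ^ 'n" where
  "R_op j f s1 s2 v =
     (if j = 1 then (\<bar>s1 - s2\<bar> / (norm (f s1 - f s2) * (s1 - s2))) *\<^sub>R (v s1 - v s2)
      else (1 / 2) *\<^sub>R (vd v s1 + vd v s2))"

definition Q_op ::
  "nat \<Rightarrow> nat \<Rightarrow> (real \<Rightarrow> real ^ 'n) \<Rightarrow> real \<Rightarrow> real \<Rightarrow> (real \<Rightarrow> real ^ 'n) \<Rightarrow> real ^ 'n" where
  "Q_op j i f s1 s2 v =
     (let si = (if i = 1 then s1 else s2) in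
      if j = 1 then vd v s1 - vd v s2
      else ((- 1) ^ (i - 1) * 2) *\<^sub>R
        (vd v si - (R_op 1 f s1 s2 f \<bullet> tangent f si) *\<^sub>R R_op 1 f s1 s2 v))"

text \<open>The indices cross over: \<open>S\<^sub>1\<close> is built from \<open>R\<^sub>2\<close> and \<open>S\<^sub>2\<close> from \<open>R\<^sub>1\<close>.\<close>
definition S_op ::
  "nat \<Rightarrow> nat \<Rightarrow> (real \<Rightarrow> real ^ 'n) \<Rightarrow> real \<Rightarrow> real \<Rightarrow>
   (real \<Rightarrow> real ^ 'n) \<Rightarrow> (real \<Rightarrow> real ^ 'n) \<Rightarrow> real" where
  "S_op j i f s1 s2 v w =
     R_op (3 - j) f s1 s2 v \<bullet> Q_op j i f s1 s2 w + Q_op j i f s1 s2 v \<bullet> R_op (3 - j) f s1 s2 w"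

end

theory Submission
  imports Defs
begin

text \<open>
  Write \<open>a = f' s1\<close>, \<open>b = f' s2\<close>, \<open>d = f s1 - f s2\<close>.  Multiplying the density by the two line
  elements cancels the normalisations of the unit tangents, and for both values of j the form
  becomes \<open>N\<^sub>j(a, b, d) / \<Phi>\<^sub>j(|d|)\<close> with the elementary numerators
  \<open>N\<^sub>1 = 2 (|a| |b| - a \<bullet> b)\<close> and \<open>N\<^sub>2 = - 4 (a \<bullet> b - (a \<bullet> d) (b \<bullet> d) / (d \<bullet> d))\<close>
  (\<open>M_form_eq_numer\<close>).  A variation of the curve moves \<open>(a, b, d)\<close> along a straight line, so
  only the pointwise values at the pair matter and the theorem is a computation in
  finitely many vectors.

  The formulas separate into two independent parts.  The terms containing \<open>\<Xi>\<^sub>j\<close> come from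
  \<open>1 / \<Phi>\<^sub>j(|d|)\<close> alone, whatever the numerator is: this is
  \<open>quotient_second_variation\<close>, where rewriting the derivative of the numerator in terms of the
  first variation G accounts for the term \<open>2 \<Xi> - \<Xi>\<^sup>2 - r \<Xi>'\<close>.
  The terms containing Q and S are the derivatives of \<open>N\<^sub>j\<close> at unit vectors a and b
  (\<open>numer_deriv_eq_operators\<close>, \<open>numer_second_derivative_eq_operators\<close>).  For j = 2 the vector
  \<open>p - (a \<bullet> d / (d \<bullet> d)) w\<close>, which is the operator Q up to a factor 2 or - 2, is the natural
  object: the second derivative is a polarised product of such vectors, minus a rank-one
  correction along d that is exactly the product of the S-terms.  The sign of \<open>\<Delta>s\<close> in \<open>R\<^sub>1\<close>
  always occurs squared and disappears.

  Since a second variation requires the first variation along the perturbed curve,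
  \<open>M_form_first_variation\<close> is stated for curves that need not be parametrised by arc length.
  All nonvanishing conditions are open, hence survive small perturbations; at the
  curve itself d is nonzero because the pair is less than one period apart and the curve is
  injective on a period.
\<close>

section \<open>Derivatives along straight lines\<close>

lemma has_real_derivative_norm_line:
  fixes a p :: "'a::real_inner"
  assumes "a + x *\<^sub>R p \<noteq> 0"
  shows "((\<lambda>t. norm (a + t *\<^sub>R p)) has_real_derivative
           ((a + x *\<^sub>R p) \<bullet> p / norm (a + x *\<^sub>R p))) (at x)"
proof -
  have pos: "(a + x *\<^sub>R p) \<bullet> (a + x *\<^sub>R p) > 0" using assms by simp
  have "((\<lambda>t. (a + t *\<^sub>R p) \<bullet> (a + t *\<^sub>R p)) has_real_derivative
           (2 * ((a + x *\<^sub>R p) \<bullet> p))) (at x)"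
    unfolding inner_simps
    by (auto intro!: derivative_eq_intros simp: inner_commute algebra_simps)
  from DERIV_chain2[OF DERIV_real_sqrt[OF pos] this]
  show ?thesis by (simp add: norm_eq_sqrt_inner divide_simps)
qed

lemma has_real_derivative_inner_line:
  fixes a b p q :: "'a::real_inner"
  shows "((\<lambda>t. (a + t *\<^sub>R p) \<bullet> (b + t *\<^sub>R q)) has_real_derivative
           (p \<bullet> (b + x *\<^sub>R q) + (a + x *\<^sub>R p) \<bullet> q)) (at x)"
  unfolding inner_simps
  by (auto intro!: derivative_eq_intros simp: inner_commute algebra_simps)

lemma has_real_derivative_inner_line_const:
  fixes a p c :: "'a::real_inner"
  shows "((\<lambda>t. (a + t *\<^sub>R p) \<bullet> c) has_real_derivative p \<bullet> c) (at x)"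
    and "((\<lambda>t. c \<bullet> (a + t *\<^sub>R p)) has_real_derivative c \<bullet> p) (at x)"
  unfolding inner_simps
  by (auto intro!: derivative_eq_intros)

lemmas line_derivs = has_real_derivative_norm_line has_real_derivative_inner_line
  has_real_derivative_inner_line_const

lemma eventually_line_nonzero:
  fixes a p :: "'a::real_normed_vector"
  assumes "a \<noteq> 0"
  shows "\<forall>\<^sub>F t in nhds 0. a + t *\<^sub>R p \<noteq> 0"
proof -
  have "((\<lambda>t. a + t *\<^sub>R p) \<longlongrightarrow> a + 0 *\<^sub>R p) (nhds (0::real))"
    by (intro tendsto_intros filterlim_ident)
  then show ?thesis using assms tendsto_imp_eventually_ne by fastforce
qed

section \<open>The numerators of the densities and their derivatives\<close>

text \<open>
  The normalising factors 2 and - 4 match those in \<^const>\<open>Phi_fun\<close>, so that the numerator is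
  \<open>Q 1 f \<bullet> Q 2 f\<close>, in the notation of the theorem, when a and b are unit vectors.
\<close>
definition numer :: "nat \<Rightarrow> 'a::real_inner \<Rightarrow> 'a \<Rightarrow> 'a \<Rightarrow> real" where
  "numer j a b d = (if j = 1 then 2 * (norm a * norm b - a \<bullet> b)
     else - 4 * (a \<bullet> b - (a \<bullet> d) * (b \<bullet> d) / (d \<bullet> d)))"

text \<open>
  The directional derivative at arbitrary nonzero (a, b, d) in the direction (p, q, w); a and b are
  not taken to be unit vectors because this expression is to be differentiated once more.
\<close>
definition numer_deriv ::
  "nat \<Rightarrow> 'a::real_inner \<Rightarrow> 'a \<Rightarrow> 'a \<Rightarrow> 'a \<Rightarrow> 'a \<Rightarrow> 'a \<Rightarrow> real" where
  "numer_deriv j a b d p q w =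
     (if j = 1 then 2 * ((a \<bullet> p) / norm a * norm b + norm a * ((b \<bullet> q) / norm b) - p \<bullet> b - a \<bullet> q)
      else - 4 * (p \<bullet> b + a \<bullet> q
        - ((p \<bullet> d + a \<bullet> w) * (b \<bullet> d) + (a \<bullet> d) * (q \<bullet> d + b \<bullet> w)) / (d \<bullet> d)
        + 2 * (a \<bullet> d) * (b \<bullet> d) * (d \<bullet> w) / (d \<bullet> d)\<^sup>2))"

lemma numer_has_derivative:
  fixes a b d p q w :: "'a::real_inner"
  assumes "a + x *\<^sub>R p \<noteq> 0" "b + x *\<^sub>R q \<noteq> 0" "d + x *\<^sub>R w \<noteq> 0"
  shows "((\<lambda>t. numer j (a + t *\<^sub>R p) (b + t *\<^sub>R q) (d + t *\<^sub>R w)) has_real_derivative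
           numer_deriv j (a + x *\<^sub>R p) (b + x *\<^sub>R q) (d + x *\<^sub>R w) p q w) (at x)"
proof (cases "j = 1")
  case True
  show ?thesis unfolding numer_def numer_deriv_def if_P[OF True]
    by (rule derivative_eq_intros line_derivs refl assms)+ (simp add: algebra_simps)
next
  case False
  \<comment> \<open>The quotient rule is applied to opaque scalars; expanding the inner products first would
    clear denominators that are long polynomials.\<close>
  define A B C where "A = (a + x *\<^sub>R p) \<bullet> (d + x *\<^sub>R w)"
    and "B = (b + x *\<^sub>R q) \<bullet> (d + x *\<^sub>R w)" and "C = (d + x *\<^sub>R w) \<bullet> (d + x *\<^sub>R w)"
  have nz: "(d + x *\<^sub>R w) \<bullet> (d + x *\<^sub>R w) \<noteq> 0" using assms by simp
  then have C: "C \<noteq> 0" unfolding C_def .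
  have quot: "((A' * B + B' * A) * C - A * B * C') / (C * C)
      = (A' * B + B' * A) / C - A * B * C' / C\<^sup>2" for A' B' C'
    using C by (simp add: divide_simps power2_eq_square)
  show ?thesis unfolding numer_def numer_deriv_def if_not_P[OF False]
    apply (rule derivative_eq_intros line_derivs refl nz)+
    unfolding A_def[symmetric] B_def[symmetric] C_def[symmetric] quot
    by (simp add: inner_commute algebra_simps)
qed

text \<open>
  The second derivative of the norm at a unit vector a is \<open>p \<bullet> p' - (a \<bullet> p) (a \<bullet> p')\<close>; together with
  the mixed terms of \<open>|a| |b|\<close> the subtracted parts form one product.
\<close>
lemma numer1_second_derivative:
  fixes a b d p q w p' q' w' :: "'a::real_inner"
  assumes "norm a = 1" "norm b = 1"
  shows "((\<lambda>t. numer_deriv 1 (a + t *\<^sub>R p) (b + t *\<^sub>R q) (d + t *\<^sub>R w) p' q' w')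
            has_real_derivative
            2 * ((p - q) \<bullet> (p' - q') - (a \<bullet> p - b \<bullet> q) * (a \<bullet> p' - b \<bullet> q'))) (at 0)"
proof -
  have nz: "a + 0 *\<^sub>R p \<noteq> 0" "b + 0 *\<^sub>R q \<noteq> 0" "norm (a + 0 *\<^sub>R p) \<noteq> 0" "norm (b + 0 *\<^sub>R q) \<noteq> 0"
    using assms by auto
  show ?thesis unfolding numer_deriv_def if_P[OF refl]
    by (rule derivative_eq_intros line_derivs refl nz)+
       (simp add: assms inner_simps inner_commute algebra_simps)
qed

text \<open>
  To first order the component of a orthogonal to d changes by A p w, up to a multiple of d.  The
  factor \<open>d \<bullet> A p w + A a d \<bullet> w\<close> is \<open>d \<bullet> p + a \<bullet> w - 2 (a \<bullet> d) (d \<bullet> w) / (d \<bullet> d)\<close>, which is the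
  derivative of \<open>(a \<bullet> d) / (d \<bullet> d)\<close> times \<open>d \<bullet> d\<close>.
\<close>
lemma numer2_second_derivative:
  fixes a b d p q w p' q' w' :: "'a::real_inner"
  assumes d: "d \<noteq> 0" and j: "j \<noteq> 1"
  defines "A \<equiv> (\<lambda>p w. p - (a \<bullet> d / (d \<bullet> d)) *\<^sub>R w)"
    and "B \<equiv> (\<lambda>q w. q - (b \<bullet> d / (d \<bullet> d)) *\<^sub>R w)"
  shows "((\<lambda>t. numer_deriv j (a + t *\<^sub>R p) (b + t *\<^sub>R q) (d + t *\<^sub>R w) p' q' w')
            has_real_derivative
            - 4 * (A p w \<bullet> B q' w' + B q w \<bullet> A p' w'
              - ((d \<bullet> A p w + A a d \<bullet> w) * (d \<bullet> B q' w' + B b d \<bullet> w')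
               + (d \<bullet> B q w + B b d \<bullet> w) * (d \<bullet> A p' w' + A a d \<bullet> w')) / (d \<bullet> d))) (at 0)"
proof -
  define D where "D = d \<bullet> d"
  have D: "D \<noteq> 0" using d unfolding D_def by simp
  have nz: "(d + 0 *\<^sub>R w) \<bullet> (d + 0 *\<^sub>R w) \<noteq> 0" "((d + 0 *\<^sub>R w) \<bullet> (d + 0 *\<^sub>R w))\<^sup>2 \<noteq> 0"
    using d by auto
  show ?thesis unfolding numer_deriv_def if_not_P[OF j]
    apply (rule derivative_eq_intros line_derivs refl nz)+
    apply (simp add: A_def B_def inner_simps inner_commute flip: D_def)
    using D apply (simp add: divide_simps)
    apply (simp add: algebra_simps eval_nat_numeral)
    done
qed

section \<open>Dividing by a function of the distance\<close>

lemma C1_pos_has_derivative: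
  assumes "C1_pos h" "x > 0"
  shows "(h has_real_derivative deriv h x) (at x)"
proof -
  have "h differentiable (at x)"
    using assms unfolding C1_pos_def differentiable_on_def
    by (metis at_within_open greaterThan_iff open_greaterThan)
  then show ?thesis
    by (simp add: DERIV_deriv_iff_real_differentiable)
qed

lemma quotient_first_variation:
  fixes d w :: "'a::real_inner"
  assumes h: "C1_pos h" "\<And>x. x > 0 \<Longrightarrow> h x \<noteq> 0" and d: "d \<noteq> 0"
    and n: "(n has_real_derivative n') (at 0)"
  shows "((\<lambda>t. n t / h (norm (d + t *\<^sub>R w))) has_real_derivative
           (n' / h (norm d) - n 0 * deriv h (norm d) * (d \<bullet> w) / (norm d * (h (norm d))\<^sup>2))) (at 0)"
proof -
  have "(h has_real_derivative deriv h (norm (d + 0 *\<^sub>R w))) (at (norm (d + 0 *\<^sub>R w)))"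
    using C1_pos_has_derivative[OF h(1)] d by simp
  from DERIV_chain'[OF has_real_derivative_norm_line this] d
  have "((\<lambda>t. h (norm (d + t *\<^sub>R w))) has_real_derivative
           deriv h (norm d) * (d \<bullet> w / norm d)) (at 0)" by simp
  from DERIV_divide[OF n this] show ?thesis using h(2)[of "norm d"] d
    by (simp add: field_simps power2_eq_square)
qed

text \<open>
  With \<open>K = 1 / h\<close> one has \<open>K' = - K \<Xi> / r\<close> and \<open>K'' = K (\<Xi>\<^sup>2 + \<Xi> - r \<Xi>') / r\<^sup>2\<close>, and the second variation
  of \<open>r = |d|\<close> is \<open>(w \<bullet> v) / r - (d \<bullet> w) (d \<bullet> v) / r\<^sup>3\<close>.  Replacing the derivatives of n by G
  turns \<open>\<Xi>\<^sup>2\<close> into \<open>\<Xi>\<^sup>2 - 2 \<Xi>\<^sup>2\<close>.  The differentiated expression is the first variation, in the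
  direction v, at the curve already moved by t along w.
\<close>
lemma quotient_second_variation:
  fixes d w v :: "'a::real_inner"
  assumes h: "C2_pos h" "\<And>x. x > 0 \<Longrightarrow> h x \<noteq> 0" and d: "d \<noteq> 0"
    and n: "(n has_real_derivative nw) (at 0)" and nv: "(nv has_real_derivative nwv) (at 0)"
  defines "r \<equiv> norm d"
  defines "\<Xi> \<equiv> (\<lambda>x. x * deriv h x / h x)"
    and "G \<equiv> (\<lambda>n' u. n' / h r - n 0 * deriv h r * (d \<bullet> u) / (r * (h r)\<^sup>2))"
  shows "((\<lambda>t. nv t / h (norm (d + t *\<^sub>R w))
             - n t * deriv h (norm (d + t *\<^sub>R w)) * ((d + t *\<^sub>R w) \<bullet> v)
               / (norm (d + t *\<^sub>R w) * (h (norm (d + t *\<^sub>R w)))\<^sup>2))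
          has_real_derivative
          (nwv / h r - G nw w * \<Xi> r * (d \<bullet> v) / r\<^sup>2 - G (nv 0) v * \<Xi> r * (d \<bullet> w) / r\<^sup>2
           - n 0 / h r * \<Xi> r * (w \<bullet> v) / r\<^sup>2
           + n 0 / h r * (2 * \<Xi> r - (\<Xi> r)\<^sup>2 - r * deriv \<Xi> r) * ((d \<bullet> w) * (d \<bullet> v)) / r ^ 4)) (at 0)"
proof -
  have r: "r > 0" using d unfolding r_def by simp
  have C1: "C1_pos h" "C1_pos (deriv h)" using h(1) unfolding C2_pos_def by auto
  define h1 h2 where "h1 = deriv h r" and "h2 = deriv (deriv h) r"
  have hr: "(h has_real_derivative h1) (at r)" "(deriv h has_real_derivative h2) (at r)"
    unfolding h1_def h2_def using C1_pos_has_derivative C1 r by blast+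
  have h0: "h r \<noteq> 0" using h(2) r by blast
  have "(\<Xi> has_real_derivative ((h1 + r * h2) * h r - r * h1 * h1) / (h r)\<^sup>2) (at r)"
    unfolding \<Xi>_def
    by (rule derivative_eq_intros refl hr h0)+ (simp add: h1_def power2_eq_square algebra_simps)
  then have Xi': "deriv \<Xi> r = ((h1 + r * h2) * h r - r * h1 * h1) / (h r)\<^sup>2"
    by (rule DERIV_imp_deriv)
  have nrm: "((\<lambda>t. norm (d + t *\<^sub>R w)) has_real_derivative (d \<bullet> w / r)) (at 0)"
    using has_real_derivative_norm_line[of d 0 w] d unfolding r_def by simp
  have hn: "((\<lambda>t. h (norm (d + t *\<^sub>R w))) has_real_derivative h1 * (d \<bullet> w / r)) (at 0)"
    and h'n: "((\<lambda>t. deriv h (norm (d + t *\<^sub>R w))) has_real_derivative h2 * (d \<bullet> w / r)) (at 0)"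
    using DERIV_chain'[OF nrm, of h h1] DERIV_chain'[OF nrm, of "deriv h" h2] hr
    by (simp_all add: r_def mult.commute)
  have nz: "h (norm (d + 0 *\<^sub>R w)) \<noteq> 0" "norm (d + 0 *\<^sub>R w) * (h (norm (d + 0 *\<^sub>R w)))\<^sup>2 \<noteq> 0"
    using h0 d unfolding r_def by auto
  show ?thesis
    apply (rule derivative_eq_intros n nv nrm hn h'n has_real_derivative_inner_line_const refl nz)+
    unfolding Xi' unfolding \<Xi>_def G_def
    apply (simp flip: r_def h1_def)
    using h0 r apply (simp add: divide_simps)
    apply (simp add: algebra_simps eval_nat_numeral)
    done
qed

section \<open>The variations of the density\<close>

text \<open>For j = 2 this holds because \<open>\<Lambda>\<close> is nonpositive, so \<open>1 / \<Phi> - \<Lambda>\<close> is positive.\<close>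
lemma Phi_fun_nonzero:
  assumes "\<And>x. x > 0 \<Longrightarrow> \<Phi> x > 0" and x: "x > 0"
  shows "Phi_fun \<Phi> j x \<noteq> 0"
proof -
  have "(LINT t:{x..}|lborel. 1 / \<Phi> t) \<ge> 0"
    unfolding set_lebesgue_integral_def
    by (rule Bochner_Integration.integral_nonneg) (use assms in \<open>auto simp: indicator_def less_imp_le\<close>)
  then have "Lam \<Phi> x \<le> 0" using x unfolding Lam_def by (simp add: divide_simps)
  moreover have "1 / \<Phi> x > 0" using assms by simp
  ultimately have "1 / \<Phi> x - Lam \<Phi> x > 0" by linarith
  then show ?thesis using assms(1)[OF x] unfolding Phi_fun_def by auto
qed

text \<open>
  The line elements cancel the denominators of the unit tangents: for j = 1 by
  \<open>|\<tau>\<^sub>1 - \<tau>\<^sub>2|\<^sup>2 = 2 - 2 \<tau>\<^sub>1 \<bullet> \<tau>\<^sub>2\<close>, for j = 2 by bilinearity of the wedge product in the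
  tangents.
\<close>
lemma M_form_eq_numer:
  assumes "vd g s1 \<noteq> 0" "vd g s2 \<noteq> 0" "g s1 \<noteq> g s2" "j \<in> {1, 2}"
  shows "M_form \<Phi> j g s1 s2 =
    numer j (vd g s1) (vd g s2) (g s1 - g s2) / Phi_fun \<Phi> j (norm (g s1 - g s2))"
proof -
  define a b d where "a = vd g s1" "b = vd g s2" "d = g s1 - g s2"
  have nz: "norm a \<noteq> 0" "norm b \<noteq> 0" "norm d \<noteq> 0" using assms unfolding a_b_d_def by auto
  show ?thesis
  proof (cases "j = 1")
    case True
    have "(norm (a /\<^sub>R norm a - b /\<^sub>R norm b))\<^sup>2 * norm a * norm b = 2 * (norm a * norm b - a \<bullet> b)"
      using nz
      unfolding power2_norm_eq_inner
      unfolding inner_diff_left inner_diff_right inner_scaleR_left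
        inner_scaleR_right
      unfolding dot_square_norm inner_commute[of b a]
      by (simp add: field_simps power2_eq_square)
    then show ?thesis using True
      by (simp add: M_form_def M_dens_def numer_def Phi_fun_def tangent_def Let_def
          flip: a_b_d_def)
  next
    case False
    have wedge: "wedge_inner (a /\<^sub>R norm a) (d /\<^sub>R norm d) (b /\<^sub>R norm b) (d /\<^sub>R norm d) * norm a * norm b
       = a \<bullet> b - (a \<bullet> d) * (b \<bullet> d) / (d \<bullet> d)"
      using nz unfolding wedge_inner_def
      by (simp add: inner_simps inner_commute dot_square_norm field_simps power2_eq_square)
    have scale: "k * E = - 4 * E / (- 4 * inverse k)" for k E :: real
      by (cases "k = 0") (simp_all add: field_simps)
    show ?thesis
      unfolding M_form_def M_dens_def numer_def Phi_fun_def tangent_def Let_def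
        if_not_P[OF False] a_b_d_def[symmetric] mult.assoc wedge[unfolded mult.assoc]
      by (rule scale)
  qed
qed

text \<open>
  Both parameters are shifted into the fundamental interval.  Equal values would then make them
  differ by a multiple of L, and half a period only leaves the multiple 0.
\<close>
lemma closed_curve_distinct_points:
  assumes "closed_curve L f" "s1 \<noteq> s2" "\<bar>s1 - s2\<bar> \<le> L / 2"
  shows "f s1 \<noteq> f s2"
proof
  assume eq: "f s1 = f s2"
  have L: "L > 0" and inj: "inj_on f {0..<L}" using assms(1) unfolding closed_curve_def by auto
  interpret periodic_fun_simple f L using assms(1) unfolding closed_curve_def by simp
  define k1 k2 where "k1 = \<lfloor>s1 / L\<rfloor>" "k2 = \<lfloor>s2 / L\<rfloor>"
  have range: "s1 - of_int k1 * L \<in> {0..<L}" "s2 - of_int k2 * L \<in> {0..<L}"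
    using floor_divide_lower[OF L] floor_divide_upper[OF L] unfolding k1_k2_def
    by (auto simp: algebra_simps)
  have "s1 - of_int k1 * L = s2 - of_int k2 * L"
    using inj_onD[OF inj _ range] eq by (simp add: minus_of_int)
  then have diff: "s1 - s2 = of_int (k1 - k2) * L" by (simp add: algebra_simps)
  then have "\<bar>of_int (k1 - k2) :: real\<bar> * L \<le> L / 2" using assms(3) L by (simp add: abs_mult)
  then have "\<bar>of_int (k1 - k2) :: real\<bar> \<le> 1 / 2"
    using L by (simp add: field_simps)
  then have "k1 - k2 = 0" by linarith
  then show False using diff assms(2) by simp
qed

lemma vd_line:
  assumes "f differentiable (at s)" "\<phi> differentiable (at s)"
  shows "vd (\<lambda>s. f s + \<epsilon> *\<^sub>R \<phi> s) s = vd f s + \<epsilon> *\<^sub>R vd \<phi> s"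
  using assms unfolding vector_derivative_works
  by (intro vector_derivative_at) (auto intro!: derivative_eq_intros)

lemma differentiable_line:
  fixes f \<phi> :: "real \<Rightarrow> 'a::real_normed_vector"
  assumes "f differentiable (at s)" "\<phi> differentiable (at s)"
  shows "(\<lambda>s. f s + \<epsilon> *\<^sub>R \<phi> s) differentiable (at s)"
  using assms by (intro derivative_intros) auto

lemma M_form_first_variation:
  assumes Phi_pos: "\<And>x. x > 0 \<Longrightarrow> \<Phi> x > 0" and j: "j \<in> {1, 2}"
    and C1: "C1_pos (Phi_fun \<Phi> j)"
    and diff: "g differentiable (at s1)" "g differentiable (at s2)"
      "\<phi> differentiable (at s1)" "\<phi> differentiable (at s2)"
    and nz: "vd g s1 \<noteq> 0" "vd g s2 \<noteq> 0" "g s1 \<noteq> g s2"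
  defines "d \<equiv> g s1 - g s2"
  shows "((\<lambda>\<epsilon>. M_form \<Phi> j (\<lambda>s. g s + \<epsilon> *\<^sub>R \<phi> s) s1 s2) has_real_derivative
     (numer_deriv j (vd g s1) (vd g s2) d (vd \<phi> s1) (vd \<phi> s2) (\<phi> s1 - \<phi> s2) / Phi_fun \<Phi> j (norm d)
      - numer j (vd g s1) (vd g s2) d * deriv (Phi_fun \<Phi> j) (norm d) * (d \<bullet> (\<phi> s1 - \<phi> s2))
        / (norm d * (Phi_fun \<Phi> j (norm d))\<^sup>2))) (at 0)"
proof -
  let ?w = "\<phi> s1 - \<phi> s2"
  define n where "n = (\<lambda>t. numer j (vd g s1 + t *\<^sub>R vd \<phi> s1) (vd g s2 + t *\<^sub>R vd \<phi> s2) (d + t *\<^sub>R ?w))"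
  have d0: "d \<noteq> 0" using nz unfolding d_def by simp
  have "(n has_real_derivative
      numer_deriv j (vd g s1) (vd g s2) d (vd \<phi> s1) (vd \<phi> s2) ?w) (at 0)"
    using numer_has_derivative[of "vd g s1" 0 "vd \<phi> s1" "vd g s2" "vd \<phi> s2" d ?w j] nz d0
    unfolding n_def by simp
  from quotient_first_variation[OF C1 Phi_fun_nonzero[OF Phi_pos] d0 this, of ?w]
  have D: "((\<lambda>t. n t / Phi_fun \<Phi> j (norm (d + t *\<^sub>R ?w))) has_real_derivative
     (numer_deriv j (vd g s1) (vd g s2) d (vd \<phi> s1) (vd \<phi> s2) ?w / Phi_fun \<Phi> j (norm d)
      - numer j (vd g s1) (vd g s2) d * deriv (Phi_fun \<Phi> j) (norm d) * (d \<bullet> ?w)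
        / (norm d * (Phi_fun \<Phi> j (norm d))\<^sup>2))) (at 0)"
    by (simp add: n_def)
  have "\<forall>\<^sub>F t in nhds 0. M_form \<Phi> j (\<lambda>s. g s + t *\<^sub>R \<phi> s) s1 s2 =
      n t / Phi_fun \<Phi> j (norm (d + t *\<^sub>R ?w))"
    using eventually_line_nonzero[OF nz(1), of "vd \<phi> s1"]
      eventually_line_nonzero[OF nz(2), of "vd \<phi> s2"] eventually_line_nonzero[OF d0, of ?w]
  proof eventually_elim
    case (elim t)
    have d_eq: "(g s1 + t *\<^sub>R \<phi> s1) - (g s2 + t *\<^sub>R \<phi> s2) = d + t *\<^sub>R ?w"
      unfolding d_def by (simp add: algebra_simps)
    then have ne: "g s1 + t *\<^sub>R \<phi> s1 \<noteq> g s2 + t *\<^sub>R \<phi> s2" using elim by force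
    show ?case
      using M_form_eq_numer[of "\<lambda>s. g s + t *\<^sub>R \<phi> s" s1 s2 j \<Phi>] elim ne j
      unfolding n_def by (simp add: vd_line diff d_eq)
  qed
  then show ?thesis using D by (subst DERIV_cong_ev[OF refl _ refl]) 
qed

section \<open>Expressing the derivatives by the operators\<close>

lemma Q_op_1: "Q_op 1 i f s1 s2 v = vd v s1 - vd v s2"
  by (simp add: Q_op_def)

text \<open>
  In the definition the factor \<open>R\<^sub>1\<close> occurs twice, so its sign and the two factors \<open>1 / |d|\<close> combine
  to \<open>1 / (d \<bullet> d)\<close>.
\<close>
lemma Q_op_2:
  assumes "s1 \<noteq> s2" "f s1 \<noteq> f s2" "norm (vd f s1) = 1" "norm (vd f s2) = 1"
  defines "d \<equiv> f s1 - f s2"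
  shows "Q_op 2 1 f s1 s2 v = 2 *\<^sub>R (vd v s1 - (vd f s1 \<bullet> d / (d \<bullet> d)) *\<^sub>R (v s1 - v s2))"
    and "Q_op 2 2 f s1 s2 v = - (2 *\<^sub>R (vd v s2 - (vd f s2 \<bullet> d / (d \<bullet> d)) *\<^sub>R (v s1 - v s2)))"
proof -
  define \<sigma> where "\<sigma> = \<bar>s1 - s2\<bar> / (norm d * (s1 - s2))"
  have "\<sigma> * \<sigma> = 1 / (d \<bullet> d)"
    using assms(1) unfolding \<sigma>_def
    by (simp add: dot_square_norm power2_eq_square flip: abs_mult)
  then have *: "\<sigma> * (d \<bullet> c) * \<sigma> = (c \<bullet> d) / (d \<bullet> d)" for c
    by (metis inner_commute mult.assoc mult.commute mult_1 times_divide_eq_left)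
  show "Q_op 2 1 f s1 s2 v = 2 *\<^sub>R (vd v s1 - (vd f s1 \<bullet> d / (d \<bullet> d)) *\<^sub>R (v s1 - v s2))"
    and "Q_op 2 2 f s1 s2 v = - (2 *\<^sub>R (vd v s2 - (vd f s2 \<bullet> d / (d \<bullet> d)) *\<^sub>R (v s1 - v s2)))"
    by (simp_all add: Q_op_def R_op_def tangent_def assms(3,4) * flip: d_def \<sigma>_def)
qed

lemma numer_deriv_eq_operators:
  assumes j: "j \<in> {1, 2}" and pts: "s1 \<noteq> s2" "f s1 \<noteq> f s2"
    and unit: "norm (vd f s1) = 1" "norm (vd f s2) = 1"
  defines "d \<equiv> f s1 - f s2"
    and "Q \<equiv> (\<lambda>i v. Q_op j i f s1 s2 v)"
  shows "numer_deriv j (vd f s1) (vd f s2) d (vd v s1) (vd v s2) (v s1 - v s2)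
     = Q 1 f \<bullet> Q 2 v + Q 2 f \<bullet> Q 1 v"
proof -
  define a b p q w where "a = vd f s1" "b = vd f s2" "p = vd v s1" "q = vd v s2" "w = v s1 - v s2"
  note ab = this
  have n: "a \<bullet> a = 1" "b \<bullet> b = 1" "norm a = 1" "norm b = 1" using unit unfolding ab by (auto simp: norm_eq_1)
  define D where "D = d \<bullet> d"
  have D: "D \<noteq> 0" using pts unfolding D_def d_def by simp
  show ?thesis
  proof (cases "j = 1")
    case True
    show ?thesis unfolding Q_def True Q_op_1 numer_deriv_def if_P[OF refl] unfolding ab[symmetric]
      by (simp add: n inner_simps inner_commute)
  next
    case False
    then have j2: "j = 2" using j by simp
    show ?thesis unfolding Q_def j2 Q_op_2[OF pts unit] numer_deriv_def d_def[symmetric] ab[symmetric]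
      using D
      by (simp add: inner_simps inner_commute D_def[symmetric]) (simp add: field_simps power2_eq_square)
  qed
qed

text \<open>
  For j = 1 both S-terms in a direction v equal \<open>f' s1 \<bullet> v' s1 - f' s2 \<bullet> v' s2\<close>; for j = 2 their products contain
  \<open>R\<^sub>1\<close> twice, which supplies the factor \<open>1 / (d \<bullet> d)\<close> of the rank-one correction.
\<close>
lemma numer_second_derivative_eq_operators:
  fixes f \<phi> \<psi> :: "real \<Rightarrow> real ^ 'n"
  assumes j: "j \<in> {1, 2}" and pts: "s1 \<noteq> s2" "f s1 \<noteq> f s2"
    and unit: "norm (vd f s1) = 1" "norm (vd f s2) = 1"
  defines "d \<equiv> f s1 - f s2"
    and "Q \<equiv> (\<lambda>i v. Q_op j i f s1 s2 v)"
    and "S \<equiv> (\<lambda>i v w. S_op j i f s1 s2 v w)"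
  shows "((\<lambda>t. numer_deriv j (vd f s1 + t *\<^sub>R vd \<phi> s1) (vd f s2 + t *\<^sub>R vd \<phi> s2)
              (d + t *\<^sub>R (\<phi> s1 - \<phi> s2)) (vd \<psi> s1) (vd \<psi> s2) (\<psi> s1 - \<psi> s2)) has_real_derivative
     Q 1 \<phi> \<bullet> Q 2 \<psi> + Q 2 \<phi> \<bullet> Q 1 \<psi> - (S 1 f \<phi> * S 2 f \<psi> + S 2 f \<phi> * S 1 f \<psi>)) (at 0)"
proof (cases "j = 1")
  case True
  define a b where "a = vd f s1" "b = vd f s2" note ab = this
  have n: "a \<bullet> a = 1" "b \<bullet> b = 1" using unit unfolding ab by (auto simp: norm_eq_1)
  have S: "S i f v = a \<bullet> vd v s1 - b \<bullet> vd v s2" for i v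
    unfolding S_def S_op_def R_op_def True Q_op_1 ab[symmetric]
    by (simp add: inner_simps inner_commute algebra_simps flip: ab)
  show ?thesis
    using numer1_second_derivative[OF unit, of "vd \<phi> s1" "vd \<phi> s2" d "\<phi> s1 - \<phi> s2" "vd \<psi> s1" "vd \<psi> s2"
        "\<psi> s1 - \<psi> s2"]
    unfolding True S Q_def Q_op_1 ab[symmetric] by simp
next
  case False
  then have j2: "j = 2" using j by simp
  have d: "d \<noteq> 0" using pts unfolding d_def by simp
  define \<sigma> where "\<sigma> = \<bar>s1 - s2\<bar> / (norm d * (s1 - s2))"
  have \<sigma>: "\<sigma> * \<sigma> = 1 / (d \<bullet> d)"
    using pts(1) unfolding \<sigma>_def by (simp add: dot_square_norm power2_eq_square flip: abs_mult)
  define A where "A = (\<lambda>p (w :: real ^ 'n). p - (vd f s1 \<bullet> d / (d \<bullet> d)) *\<^sub>R w)"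
  define B where "B = (\<lambda>q (w :: real ^ 'n). q - (vd f s2 \<bullet> d / (d \<bullet> d)) *\<^sub>R w)"
  have QA: "Q 1 v = 2 *\<^sub>R A (vd v s1) (v s1 - v s2)" and QB: "Q 2 v = - (2 *\<^sub>R B (vd v s2) (v s1 - v s2))" for v
    unfolding Q_def j2 Q_op_2[OF pts unit] d_def[symmetric] A_def B_def by simp_all
  have R: "R_op (3 - j) f s1 s2 v = \<sigma> *\<^sub>R (v s1 - v s2)" for v
    by (simp add: R_op_def j2 \<sigma>_def d_def)
  have S_eq: "S i f v = \<sigma> * (d \<bullet> Q i v + Q i f \<bullet> (v s1 - v s2))" for i v
    unfolding S_def S_op_def R by (simp add: Q_def d_def algebra_simps)
  have SS: "S i f v * S k f u = (d \<bullet> Q i v + Q i f \<bullet> (v s1 - v s2)) * (d \<bullet> Q k u + Q k f \<bullet> (u s1 - u s2)) / (d \<bullet> d)"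
    for i k v u
  proof -
    have "S i f v * S k f u = (\<sigma> * \<sigma>) * ((d \<bullet> Q i v + Q i f \<bullet> (v s1 - v s2)) * (d \<bullet> Q k u + Q k f \<bullet> (u s1 - u s2)))"
      unfolding S_eq by (simp only: mult_ac)
    then show ?thesis unfolding \<sigma> by simp
  qed
  define w w' where "w = \<phi> s1 - \<phi> s2" and "w' = \<psi> s1 - \<psi> s2"
  have "((\<lambda>t. numer_deriv j (vd f s1 + t *\<^sub>R vd \<phi> s1) (vd f s2 + t *\<^sub>R vd \<phi> s2)
            (d + t *\<^sub>R w) (vd \<psi> s1) (vd \<psi> s2) w') has_real_derivative
          - 4 * (A (vd \<phi> s1) w \<bullet> B (vd \<psi> s2) w' + B (vd \<phi> s2) w \<bullet> A (vd \<psi> s1) w'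
            - ((d \<bullet> A (vd \<phi> s1) w + A (vd f s1) d \<bullet> w) * (d \<bullet> B (vd \<psi> s2) w' + B (vd f s2) d \<bullet> w')
             + (d \<bullet> B (vd \<phi> s2) w + B (vd f s2) d \<bullet> w)
               * (d \<bullet> A (vd \<psi> s1) w' + A (vd f s1) d \<bullet> w')) / (d \<bullet> d))) (at 0)"
    unfolding A_def B_def by (rule numer2_second_derivative[OF d False])
  then show ?thesis
    unfolding SS QA QB d_def[symmetric] w_def[symmetric] w'_def[symmetric]
      inner_scaleR_left inner_scaleR_right inner_minus_left inner_minus_right
    by (rule DERIV_cong) (use d in \<open>simp add: field_simps\<close>)
qed

section \<open>The variational formulas\<close>

theorem theorem3p1:
  fixes \<Phi> :: "real \<Rightarrow> real"
    and f \<phi> \<psi> :: "real \<Rightarrow> real ^ 'n"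
    and L s1 s2 :: real
    and j :: nat
  assumes Phi_pos: "\<And>x. x > 0 \<Longrightarrow> \<Phi> x > 0"
    and cond1: "mono_on {0<..} \<Phi>"
    and cond2: "\<And>x. x > 0 \<Longrightarrow> set_integrable lborel {x..} (\<lambda>t. 1 / \<Phi> t)"
    and cond3: "\<And>(l::real) (g :: real \<Rightarrow> real ^ 'n).
      l > 0 \<Longrightarrow> closed_curve l g \<Longrightarrow> energy \<Phi> l g < \<infinity> \<Longrightarrow>
      g \<in> W_Phi \<Phi> l \<inter> W1inf l \<and> bi_lipschitz l g"
    and cond4: "\<And>(l::real) (g :: real \<Rightarrow> real ^ 'n) g'.
      l > 0 \<Longrightarrow> bi_lipschitz l g \<Longrightarrow> g \<in> W_Phi \<Phi> l \<inter> W1inf l \<Longrightarrow>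
      weak_derivative l g g' \<Longrightarrow> (AE s in lborel. norm (g' s) = 1) \<Longrightarrow>
      ((\<lambda>\<epsilon>. \<epsilon> * (LINT s:{0..l}|lborel. Lam \<Phi> (norm (g s - g (s + \<epsilon>))) - Lam \<Phi> \<epsilon>))
         \<longlongrightarrow> 0) (at_right 0) \<and>
      ((\<lambda>\<epsilon>. LINT s:{0..l}|lborel. Lam \<Phi> (norm (g s - g (s + \<epsilon>))) *
          (LINT t:{s..s + \<epsilon>}|lborel. (norm (g' s - g' t))\<^sup>2))
         \<longlongrightarrow> 0) (at_right 0)"
    and cond5a: "\<And>l c :: real. l > 0 \<Longrightarrow> c \<in> {0<..<1} \<Longrightarrow>
      \<exists>C>0. \<forall>x\<in>{0<..l / 2}. \<Phi> (c * x) \<ge> C * \<Phi> x"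
    and cond5b: "\<And>l::real. l > 0 \<Longrightarrow>
      (INF x\<in>{0<..l / 2}. ereal (1 / \<Phi> x + Lam \<Phi> x)) \<ge> 0"
    and j: "j \<in> {1, 2}"
    and L: "L > 0"
    and f: "closed_curve L f"
    and periodic: "periodic_fun_simple \<phi> L" "periodic_fun_simple \<psi> L"
    and pair: "s1 \<noteq> s2" "\<bar>s1 - s2\<bar> \<le> L / 2"
    and tangents: "has_unit_tangent f s1" "has_unit_tangent f s2"
    and diff_phi: "\<phi> differentiable (at s1)" "\<phi> differentiable (at s2)"
    and diff_psi: "\<psi> differentiable (at s1)" "\<psi> differentiable (at s2)"
  defines "\<Delta>f \<equiv> f s1 - f s2"
    and "\<Delta>\<phi> \<equiv> \<phi> s1 - \<phi> s2"
    and "\<Delta>\<psi> \<equiv> \<psi> s1 - \<psi> s2"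
    and "Q \<equiv> (\<lambda>i v. Q_op j i f s1 s2 v)"
    and "S \<equiv> (\<lambda>i v w. S_op j i f s1 s2 v w)"
    and "\<Phi>j \<equiv> Phi_fun \<Phi> j"
    and "\<Xi> \<equiv> Xi \<Phi> j"
    and "M \<equiv> M_dens \<Phi> j f s1 s2"
    and "G \<equiv> (\<lambda>v. G_var \<Phi> j f v s1 s2)"
    and "H \<equiv> (\<lambda>v w. H_var \<Phi> j f v w s1 s2)"
  shows "(C1_pos \<Phi>j \<longrightarrow>
      G_exists \<Phi> j f \<phi> s1 s2 \<and>
      G \<phi> = (Q 1 f \<bullet> Q 2 \<phi> + Q 2 f \<bullet> Q 1 \<phi>) / \<Phi>j (norm \<Delta>f)
        - M * deriv \<Phi>j (norm \<Delta>f) * (\<Delta>f \<bullet> \<Delta>\<phi>) / (norm \<Delta>f * \<Phi>j (norm \<Delta>f))) \<and>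
    (C2_pos \<Phi>j \<longrightarrow>
      H_exists \<Phi> j f \<phi> \<psi> s1 s2 \<and>
      H \<phi> \<psi> = (Q 1 \<phi> \<bullet> Q 2 \<psi> + Q 2 \<phi> \<bullet> Q 1 \<psi>
            - (S 1 f \<phi> * S 2 f \<psi> + S 2 f \<phi> * S 1 f \<psi>)) / \<Phi>j (norm \<Delta>f)
        - G \<phi> * \<Xi> (norm \<Delta>f) * (\<Delta>f \<bullet> \<Delta>\<psi>) / (norm \<Delta>f)\<^sup>2
        - G \<psi> * \<Xi> (norm \<Delta>f) * (\<Delta>f \<bullet> \<Delta>\<phi>) / (norm \<Delta>f)\<^sup>2
        - M * \<Xi> (norm \<Delta>f) * (\<Delta>\<phi> \<bullet> \<Delta>\<psi>) / (norm \<Delta>f)\<^sup>2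
        + M * (2 * \<Xi> (norm \<Delta>f) - (\<Xi> (norm \<Delta>f))\<^sup>2 - norm \<Delta>f * deriv \<Xi> (norm \<Delta>f))
            * ((\<Delta>f \<bullet> \<Delta>\<phi>) * (\<Delta>f \<bullet> \<Delta>\<psi>)) / (norm \<Delta>f) ^ 4)"
proof -
  have dist: "f s1 \<noteq> f s2" using closed_curve_distinct_points[OF f pair] .
  then have d0: "\<Delta>f \<noteq> 0" unfolding \<Delta>f_def by simp
  have unit: "norm (vd f s1) = 1" "norm (vd f s2) = 1"
    and df: "f differentiable (at s1)" "f differentiable (at s2)"
    using tangents unfolding has_unit_tangent_def by auto
  have nz: "vd f s1 \<noteq> 0" "vd f s2 \<noteq> 0" using unit by auto
  have Phi0: "\<And>x. x > 0 \<Longrightarrow> \<Phi>j x \<noteq> 0" unfolding \<Phi>j_def by (rule Phi_fun_nonzero[OF Phi_pos])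
  define N where "N = numer j (vd f s1) (vd f s2) \<Delta>f"
  define N' where "N' = (\<lambda>v. Q 1 f \<bullet> Q 2 v + Q 2 f \<bullet> Q 1 v)"
  have M: "M = N / \<Phi>j (norm \<Delta>f)"
    using M_form_eq_numer[OF nz dist j, of \<Phi>] unit
    unfolding M_form_def M_def N_def \<Phi>j_def \<Delta>f_def by simp
  have N': "numer_deriv j (vd f s1) (vd f s2) \<Delta>f (vd v s1) (vd v s2) (v s1 - v s2) = N' v" for v
    using numer_deriv_eq_operators[OF j pair(1) dist unit] unfolding N'_def Q_def \<Delta>f_def .
  have first: "((\<lambda>\<epsilon>. M_form \<Phi> j (\<lambda>s. f s + \<epsilon> *\<^sub>R v s) s1 s2) has_real_derivative
      (N' v / \<Phi>j (norm \<Delta>f) - N * deriv \<Phi>j (norm \<Delta>f) * (\<Delta>f \<bullet> (v s1 - v s2))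
        / (norm \<Delta>f * (\<Phi>j (norm \<Delta>f))\<^sup>2))) (at 0)"
    if "C1_pos \<Phi>j" "v differentiable (at s1)" "v differentiable (at s2)" for v
    using M_form_first_variation[OF Phi_pos j that(1)[unfolded \<Phi>j_def] df that(2,3) nz dist]
    unfolding \<Delta>f_def[symmetric] N' unfolding N_def \<Phi>j_def by simp
  have G: "G v = N' v / \<Phi>j (norm \<Delta>f) - N * deriv \<Phi>j (norm \<Delta>f) * (\<Delta>f \<bullet> (v s1 - v s2))
        / (norm \<Delta>f * (\<Phi>j (norm \<Delta>f))\<^sup>2)"
    if "C1_pos \<Phi>j" "v differentiable (at s1)" "v differentiable (at s2)" for v
    using DERIV_imp_deriv[OF first[OF that]] unfolding G_def G_var_def .
  have one: "G_exists \<Phi> j f \<phi> s1 s2 \<and>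
      G \<phi> = (Q 1 f \<bullet> Q 2 \<phi> + Q 2 f \<bullet> Q 1 \<phi>) / \<Phi>j (norm \<Delta>f)
        - M * deriv \<Phi>j (norm \<Delta>f) * (\<Delta>f \<bullet> \<Delta>\<phi>) / (norm \<Delta>f * \<Phi>j (norm \<Delta>f))"
    if C1: "C1_pos \<Phi>j"
  proof
    show "G_exists \<Phi> j f \<phi> s1 s2"
      using first[OF C1 diff_phi] unfolding G_exists_def
      by (auto simp: real_differentiable_def)
    show "G \<phi> = (Q 1 f \<bullet> Q 2 \<phi> + Q 2 f \<bullet> Q 1 \<phi>) / \<Phi>j (norm \<Delta>f)
        - M * deriv \<Phi>j (norm \<Delta>f) * (\<Delta>f \<bullet> \<Delta>\<phi>) / (norm \<Delta>f * \<Phi>j (norm \<Delta>f))"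
      unfolding G[OF C1 diff_phi] M N'_def \<Delta>\<phi>_def by (simp add: power2_eq_square field_simps)
  qed
  have two: "H_exists \<Phi> j f \<phi> \<psi> s1 s2 \<and>
      H \<phi> \<psi> = (Q 1 \<phi> \<bullet> Q 2 \<psi> + Q 2 \<phi> \<bullet> Q 1 \<psi>
            - (S 1 f \<phi> * S 2 f \<psi> + S 2 f \<phi> * S 1 f \<psi>)) / \<Phi>j (norm \<Delta>f)
        - G \<phi> * \<Xi> (norm \<Delta>f) * (\<Delta>f \<bullet> \<Delta>\<psi>) / (norm \<Delta>f)\<^sup>2
        - G \<psi> * \<Xi> (norm \<Delta>f) * (\<Delta>f \<bullet> \<Delta>\<phi>) / (norm \<Delta>f)\<^sup>2
        - M * \<Xi> (norm \<Delta>f) * (\<Delta>\<phi> \<bullet> \<Delta>\<psi>) / (norm \<Delta>f)\<^sup>2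
        + M * (2 * \<Xi> (norm \<Delta>f) - (\<Xi> (norm \<Delta>f))\<^sup>2 - norm \<Delta>f * deriv \<Xi> (norm \<Delta>f))
            * ((\<Delta>f \<bullet> \<Delta>\<phi>) * (\<Delta>f \<bullet> \<Delta>\<psi>)) / (norm \<Delta>f) ^ 4"
    if C2: "C2_pos \<Phi>j"
  proof -
    have C1: "C1_pos \<Phi>j" using C2 unfolding C2_pos_def by simp
    \<comment> \<open>The data of the curve moved by t along \<open>\<phi>\<close>; F t is its first variation along \<open>\<psi>\<close>.\<close>
    define a b where "a = (\<lambda>t. vd f s1 + t *\<^sub>R vd \<phi> s1)" and "b = (\<lambda>t. vd f s2 + t *\<^sub>R vd \<phi> s2)"
    define d where "d = (\<lambda>t. \<Delta>f + t *\<^sub>R \<Delta>\<phi>)"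
    define n where "n = (\<lambda>t. numer j (a t) (b t) (d t))"
    define n\<psi> where "n\<psi> = (\<lambda>t. numer_deriv j (a t) (b t) (d t) (vd \<psi> s1) (vd \<psi> s2) \<Delta>\<psi>)"
    define F where "F = (\<lambda>t. n\<psi> t / \<Phi>j (norm (d t))
        - n t * deriv \<Phi>j (norm (d t)) * (d t \<bullet> \<Delta>\<psi>) / (norm (d t) * (\<Phi>j (norm (d t)))\<^sup>2))"
    have "\<forall>\<^sub>F \<epsilon> in nhds 0. ((\<lambda>\<eta>. pert2 \<Phi> j f \<phi> \<psi> s1 s2 \<epsilon> \<eta>) has_real_derivative F \<epsilon>) (at 0)"
      using eventually_line_nonzero[OF nz(1), of "vd \<phi> s1"]
        eventually_line_nonzero[OF nz(2), of "vd \<phi> s2"] eventually_line_nonzero[OF d0, of \<Delta>\<phi>]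
    proof eventually_elim
      case (elim t)
      let ?g = "\<lambda>s. f s + t *\<^sub>R \<phi> s"
      have eqs: "vd ?g s1 = a t" "vd ?g s2 = b t" "?g s1 - ?g s2 = d t"
        unfolding a_def b_def d_def \<Delta>f_def \<Delta>\<phi>_def
        by (simp_all add: vd_line df diff_phi algebra_simps)
      have nz': "vd ?g s1 \<noteq> 0" "vd ?g s2 \<noteq> 0" using elim unfolding eqs a_def b_def by auto
      have ne': "?g s1 \<noteq> ?g s2" using elim(3) eqs(3) unfolding d_def by auto
      show ?case
        using M_form_first_variation[OF Phi_pos j C1[unfolded \<Phi>j_def]
            differentiable_line[OF df(1) diff_phi(1)] differentiable_line[OF df(2) diff_phi(2)]
            diff_psi nz' ne']
        unfolding eqs F_def n_def n\<psi>_def pert2_def \<Phi>j_def \<Delta>\<psi>_def .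
    qed
    then have ev: "\<forall>\<^sub>F \<epsilon> in nhds 0. ((\<lambda>\<eta>. pert2 \<Phi> j f \<phi> \<psi> s1 s2 \<epsilon> \<eta>) differentiable (at 0))
        \<and> deriv (\<lambda>\<eta>. pert2 \<Phi> j f \<phi> \<psi> s1 s2 \<epsilon> \<eta>) 0 = F \<epsilon>"
      by eventually_elim (auto simp: real_differentiable_def DERIV_imp_deriv)
    have n': "(n has_real_derivative N' \<phi>) (at 0)"
      using numer_has_derivative[of "vd f s1" 0 "vd \<phi> s1" "vd f s2" "vd \<phi> s2" \<Delta>f \<Delta>\<phi> j] nz d0
      unfolding n_def a_def b_def d_def by (simp add: N'[symmetric] \<Delta>\<phi>_def)
    have n\<psi>': "(n\<psi> has_real_derivative Q 1 \<phi> \<bullet> Q 2 \<psi> + Q 2 \<phi> \<bullet> Q 1 \<psi>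
            - (S 1 f \<phi> * S 2 f \<psi> + S 2 f \<phi> * S 1 f \<psi>)) (at 0)"
      using numer_second_derivative_eq_operators[OF j pair(1) dist unit, of \<phi> \<psi>]
      unfolding n\<psi>_def a_def b_def d_def Q_def S_def \<Delta>f_def \<Delta>\<phi>_def \<Delta>\<psi>_def .
    have at0: "n 0 = N" "n\<psi> 0 = N' \<psi>"
      unfolding n_def n\<psi>_def N_def a_def b_def d_def by (simp_all add: N'[symmetric] \<Delta>\<psi>_def)
    have Xi: "(\<lambda>x. x * deriv \<Phi>j x / \<Phi>j x) = \<Xi>"
        "norm \<Delta>f * deriv \<Phi>j (norm \<Delta>f) / \<Phi>j (norm \<Delta>f) = \<Xi> (norm \<Delta>f)" unfolding \<Xi>_def \<Phi>j_def Xi_def by auto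
    have F': "(F has_real_derivative
       ((Q 1 \<phi> \<bullet> Q 2 \<psi> + Q 2 \<phi> \<bullet> Q 1 \<psi>
            - (S 1 f \<phi> * S 2 f \<psi> + S 2 f \<phi> * S 1 f \<psi>)) / \<Phi>j (norm \<Delta>f)
        - G \<phi> * \<Xi> (norm \<Delta>f) * (\<Delta>f \<bullet> \<Delta>\<psi>) / (norm \<Delta>f)\<^sup>2
        - G \<psi> * \<Xi> (norm \<Delta>f) * (\<Delta>f \<bullet> \<Delta>\<phi>) / (norm \<Delta>f)\<^sup>2
        - M * \<Xi> (norm \<Delta>f) * (\<Delta>\<phi> \<bullet> \<Delta>\<psi>) / (norm \<Delta>f)\<^sup>2
        + M * (2 * \<Xi> (norm \<Delta>f) - (\<Xi> (norm \<Delta>f))\<^sup>2 - norm \<Delta>f * deriv \<Xi> (norm \<Delta>f))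
            * ((\<Delta>f \<bullet> \<Delta>\<phi>) * (\<Delta>f \<bullet> \<Delta>\<psi>)) / (norm \<Delta>f) ^ 4)) (at 0)"
      unfolding F_def d_def G[OF C1 diff_phi] G[OF C1 diff_psi] M
        \<Delta>\<phi>_def[symmetric] \<Delta>\<psi>_def[symmetric]
      by (rule quotient_second_variation[OF C2 Phi0 d0 n' n\<psi>', unfolded at0 Xi])
    have "\<forall>\<^sub>F \<epsilon> in nhds 0. deriv (\<lambda>\<eta>. pert2 \<Phi> j f \<phi> \<psi> s1 s2 \<epsilon> \<eta>) 0 = F \<epsilon>"
      using ev by eventually_elim simp
    from DERIV_cong_ev[OF refl this refl] F'
    have H': "((\<lambda>\<epsilon>. deriv (\<lambda>\<eta>. pert2 \<Phi> j f \<phi> \<psi> s1 s2 \<epsilon> \<eta>) 0) has_real_derivative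
       ((Q 1 \<phi> \<bullet> Q 2 \<psi> + Q 2 \<phi> \<bullet> Q 1 \<psi>
            - (S 1 f \<phi> * S 2 f \<psi> + S 2 f \<phi> * S 1 f \<psi>)) / \<Phi>j (norm \<Delta>f)
        - G \<phi> * \<Xi> (norm \<Delta>f) * (\<Delta>f \<bullet> \<Delta>\<psi>) / (norm \<Delta>f)\<^sup>2
        - G \<psi> * \<Xi> (norm \<Delta>f) * (\<Delta>f \<bullet> \<Delta>\<phi>) / (norm \<Delta>f)\<^sup>2
        - M * \<Xi> (norm \<Delta>f) * (\<Delta>\<phi> \<bullet> \<Delta>\<psi>) / (norm \<Delta>f)\<^sup>2
        + M * (2 * \<Xi> (norm \<Delta>f) - (\<Xi> (norm \<Delta>f))\<^sup>2 - norm \<Delta>f * deriv \<Xi> (norm \<Delta>f))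
            * ((\<Delta>f \<bullet> \<Delta>\<phi>) * (\<Delta>f \<bullet> \<Delta>\<psi>)) / (norm \<Delta>f) ^ 4)) (at 0)"
      by blast
    have "H_exists \<Phi> j f \<phi> \<psi> s1 s2"
      unfolding H_exists_def
    proof
      show "\<forall>\<^sub>F \<epsilon> in nhds 0. (\<lambda>\<eta>. pert2 \<Phi> j f \<phi> \<psi> s1 s2 \<epsilon> \<eta>) differentiable (at 0)"
        using ev by eventually_elim simp
      show "(\<lambda>\<epsilon>. deriv (\<lambda>\<eta>. pert2 \<Phi> j f \<phi> \<psi> s1 s2 \<epsilon> \<eta>) 0) differentiable (at 0)"
        using H' by (auto simp: real_differentiable_def)
    qed
    with DERIV_imp_deriv[OF H'] show ?thesis unfolding H_def H_var_def by simp
  qed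
  show ?thesis using one two by blast
qed

end
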